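(* Let $\mathcal{F}$ be a real Hilbert space and let $\Phi:\mathcal{F}\to(-\infty,\infty]$ be a Legendre-type generator with $\mathcal{A}=\operatorname{int}(\operatorname{dom}\Phi)$ and convex conjugate $\Phi^\ast$. Then for all $f,g\in\mathcal{A}$, $$d_\Phi(g,f)=d_{\Phi^\ast}\bigl(\nabla\Phi(f),\nabla\Phi(g)\bigr).$$
   Context: A function $\Phi:\mathcal{F}\to(-\infty,\infty]$ on a real Hilbert space $\mathcal{F}$ (of real-valued functions on a set $\mathcal{X}\subseteq\mathbb{R}^d$) is called a generator if it is proper, lower semicontinuous, strictly convex, and Fréchet differentiable on $\mathcal{A}=\operatorname{int}(\operatorname{dom}\Phi)\neq\emptyset$. Throughout, $\nabla$ denotes the Fréchet gradient, i.e. the Riesz representer in $\mathcal{F}$ of the Fréchet derivative. The functional Bregman divergence generated by $\Phi$ is, for $f,g\in\mathcal{A}$, $d_\Phi(f,g)=\Phi(f)-\Phi(g)-\langle\nabla\Phi(g),f-g\rangle_{\mathcal{F}}$. A generator is of Legendre type if it is additionally essentially smooth ($\partial\Phi$ is locally bounded and single-valued on its domain) and essentially strictly convex ($(\partial\Phi)^{-1}$ is locally bounded on its domain and $\Phi$ is strictly convex on every convex subset of $\operatorname{dom}\partial\Phi$). The dual space of $\mathcal{F}$ is identified with $\mathcal{F}$ itself via the Riesz representation, and the convex conjugate $\Phi^\ast:\mathcal{F}\to(-\infty,\infty]$ is $\Phi^\ast(u)=\sup_{f\in\mathcal{F}}\{\langle u,f\rangle_{\mathcal{F}}-\Phi(f)\}$.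 The divergence $d_{\Phi^\ast}$ is given by the same formula with $\Phi^\ast$ in place of $\Phi$: $d_{\Phi^\ast}(u,v)=\Phi^\ast(u)-\Phi^\ast(v)-\langle\nabla\Phi^\ast(v),u-v\rangle_{\mathcal{F}}$, with $\nabla\Phi^\ast(v)$ the Fréchet gradient of $\Phi^\ast$ at $v$.
   Formalization: The Fréchet gradient of Φ* at ∇Φ(g) need not exist for a Legendre-type generator, so the identity is stated with it only where it exists; in addition, Φ* is shown Gateaux differentiable at ∇Φ(g) and the identity holds with the Gateaux gradient for all f, g in A. *)

theory Defs
  imports "HOL-Analysis.Analysis"
begin

text \<open>
  Functions into $(-\infty,\infty]$ are rendered as functions into \<^typ>\<open>ereal\<close>; the exclusion of
  the value \<open>- \<infinity>\<close> is part of \<open>proper\<close>.  A real Hilbert space is a type of class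
  \<^class>\<open>real_inner\<close> and \<^class>\<open>complete_space\<close>, identified with its dual by the inner product.
\<close>

definition edom :: "('a \<Rightarrow> ereal) \<Rightarrow> 'a set" where
  "edom \<Phi> = {x. \<Phi> x < \<infinity>}"

definition proper :: "('a \<Rightarrow> ereal) \<Rightarrow> bool" where
  "proper \<Phi> \<longleftrightarrow> edom \<Phi> \<noteq> {} \<and> (\<forall>x. \<Phi> x \<noteq> -\<infinity>)"

definition lower_semicontinuous :: "('a::topological_space \<Rightarrow> ereal) \<Rightarrow> bool" where
  "lower_semicontinuous \<Phi> \<longleftrightarrow> (\<forall>x. \<forall>a < \<Phi> x. \<forall>\<^sub>F y in nhds x. a < \<Phi> y)"

definition strictly_convex_on :: "'a::real_vector set \<Rightarrow> ('a \<Rightarrow> ereal) \<Rightarrow> bool" where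
  "strictly_convex_on C \<Phi> \<longleftrightarrow>
     (\<forall>x\<in>C. \<forall>y\<in>C. \<forall>t::real. x \<noteq> y \<longrightarrow> 0 < t \<longrightarrow> t < 1 \<longrightarrow>
        \<Phi> ((1 - t) *\<^sub>R x + t *\<^sub>R y) < ereal (1 - t) * \<Phi> x + ereal t * \<Phi> y)"

text \<open>
  Differentiability is only considered at interior points of the domain; near such a point a
  proper function is finite, so \<^const>\<open>real_of_ereal\<close> does not lose information.
\<close>

definition has_frechet_gradient :: "('a::real_inner \<Rightarrow> ereal) \<Rightarrow> 'a \<Rightarrow> 'a \<Rightarrow> bool" where
  "has_frechet_gradient \<Phi> x D \<longleftrightarrow>
     x \<in> interior (edom \<Phi>) \<and> (GDERIV (\<lambda>y. real_of_ereal (\<Phi> y)) x :> D)"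

definition frechet_differentiable_at :: "('a::real_inner \<Rightarrow> ereal) \<Rightarrow> 'a \<Rightarrow> bool" where
  "frechet_differentiable_at \<Phi> x \<longleftrightarrow> (\<exists>D. has_frechet_gradient \<Phi> x D)"

definition frechet_gradient :: "('a::real_inner \<Rightarrow> ereal) \<Rightarrow> 'a \<Rightarrow> 'a" where
  "frechet_gradient \<Phi> x = (THE D. has_frechet_gradient \<Phi> x D)"

definition has_gateaux_gradient :: "('a::real_inner \<Rightarrow> ereal) \<Rightarrow> 'a \<Rightarrow> 'a \<Rightarrow> bool" where
  "has_gateaux_gradient \<Phi> x D \<longleftrightarrow>
     x \<in> interior (edom \<Phi>) \<and>
     (\<forall>h. ((\<lambda>t. real_of_ereal (\<Phi> (x + t *\<^sub>R h))) has_real_derivative inner D h) (at 0))"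

definition gateaux_differentiable_at :: "('a::real_inner \<Rightarrow> ereal) \<Rightarrow> 'a \<Rightarrow> bool" where
  "gateaux_differentiable_at \<Phi> x \<longleftrightarrow> (\<exists>D. has_gateaux_gradient \<Phi> x D)"

definition gateaux_gradient :: "('a::real_inner \<Rightarrow> ereal) \<Rightarrow> 'a \<Rightarrow> 'a" where
  "gateaux_gradient \<Phi> x = (THE D. has_gateaux_gradient \<Phi> x D)"

definition generator :: "('a::{real_inner,complete_space} \<Rightarrow> ereal) \<Rightarrow> bool" where
  "generator \<Phi> \<longleftrightarrow>
     proper \<Phi> \<and> lower_semicontinuous \<Phi> \<and> strictly_convex_on (edom \<Phi>) \<Phi> \<and>
     interior (edom \<Phi>) \<noteq> {} \<and>
     (\<forall>x \<in> interior (edom \<Phi>). frechet_differentiable_at \<Phi> x)"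

definition subdifferential :: "('a::real_inner \<Rightarrow> ereal) \<Rightarrow> 'a \<Rightarrow> 'a set" where
  "subdifferential \<Phi> x =
     {u. x \<in> edom \<Phi> \<and> (\<forall>y. \<Phi> x + ereal (inner u (y - x)) \<le> \<Phi> y)}"

text \<open>Set-valued operators are functions into sets; their domain is where the value is nonempty.\<close>

definition op_dom :: "('a \<Rightarrow> 'b set) \<Rightarrow> 'a set" where
  "op_dom T = {x. T x \<noteq> {}}"

definition op_inverse :: "('a \<Rightarrow> 'b set) \<Rightarrow> 'b \<Rightarrow> 'a set" where
  "op_inverse T u = {x. u \<in> T x}"

definition locally_bounded_on_dom :: "('a::topological_space \<Rightarrow> 'b::metric_space set) \<Rightarrow> bool" where
  "locally_bounded_on_dom T \<longleftrightarrow>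
     (\<forall>x \<in> op_dom T. \<exists>U. open U \<and> x \<in> U \<and> bounded (\<Union>y\<in>U. T y))"

definition single_valued_on_dom :: "('a \<Rightarrow> 'b set) \<Rightarrow> bool" where
  "single_valued_on_dom T \<longleftrightarrow> (\<forall>x \<in> op_dom T. \<exists>!u. u \<in> T x)"

definition essentially_smooth :: "('a::real_inner \<Rightarrow> ereal) \<Rightarrow> bool" where
  "essentially_smooth \<Phi> \<longleftrightarrow>
     locally_bounded_on_dom (subdifferential \<Phi>) \<and> single_valued_on_dom (subdifferential \<Phi>)"

definition essentially_strictly_convex :: "('a::real_inner \<Rightarrow> ereal) \<Rightarrow> bool" where
  "essentially_strictly_convex \<Phi> \<longleftrightarrow>
     locally_bounded_on_dom (op_inverse (subdifferential \<Phi>)) \<and>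
     (\<forall>C. convex C \<and> C \<subseteq> op_dom (subdifferential \<Phi>) \<longrightarrow> strictly_convex_on C \<Phi>)"

definition legendre_generator :: "('a::{real_inner,complete_space} \<Rightarrow> ereal) \<Rightarrow> bool" where
  "legendre_generator \<Phi> \<longleftrightarrow>
     generator \<Phi> \<and> essentially_smooth \<Phi> \<and> essentially_strictly_convex \<Phi>"

definition conjugate :: "('a::real_inner \<Rightarrow> ereal) \<Rightarrow> 'a \<Rightarrow> ereal" where
  "conjugate \<Phi> u = (SUP f. ereal (inner u f) - \<Phi> f)"

text \<open>
  The divergences are extended reals, so that an equation between a divergence of \<open>\<Phi>\<close> at points
  of \<open>interior (edom \<Phi>)\<close> and one of \<open>conjugate \<Phi>\<close> forces the values of the conjugate to be finite.
  The divergence with the Gateaux gradient is needed for the conjugate: in infinite dimension the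
  conjugate of a Legendre-type generator is Gateaux but in general not Frechet differentiable.
  Where the Frechet gradient exists, the two gradients, hence the two divergences, coincide.
\<close>

definition bregman_div :: "('a::real_inner \<Rightarrow> ereal) \<Rightarrow> 'a \<Rightarrow> 'a \<Rightarrow> ereal" where
  "bregman_div \<Phi> f g = \<Phi> f - \<Phi> g - ereal (inner (frechet_gradient \<Phi> g) (f - g))"

definition bregman_div_gateaux :: "('a::real_inner \<Rightarrow> ereal) \<Rightarrow> 'a \<Rightarrow> 'a \<Rightarrow> ereal" where
  "bregman_div_gateaux \<Phi> f g = \<Phi> f - \<Phi> g - ereal (inner (gateaux_gradient \<Phi> g) (f - g))"

end

theory Submission
  imports Defs
begin

text \<open>
  Once \<open>conjugate \<Phi>\<close> is known to have Gateaux gradient \<open>g\<close> at \<open>v = \<nabla>\<Phi>(g)\<close>, the claim is the equality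
  case of the Fenchel-Young inequality.

  Finiteness of the conjugate near \<open>v\<close> comes from the local boundedness of the inverse
  subdifferential: for \<open>u\<close> near \<open>v\<close>, the minimiser \<open>x\<close> of the regularised function
  \<open>\<Phi>(x) - \<langle>u, x\<rangle> + \<epsilon>/2 * |x - g|^2\<close> satisfies \<open>w = u - \<epsilon>(x - g) \<in> \<partial>\<Phi>(x)\<close>, and monotonicity of
  \<open>\<partial>\<Phi>\<close> keeps \<open>w\<close> near \<open>v\<close>.  Hence \<open>x\<close> is bounded uniformly in \<open>\<epsilon>\<close>, and letting \<open>\<epsilon>\<close> tend to \<open>0\<close>
  bounds \<open>conjugate \<Phi> u\<close>.

  Boundedness of the conjugate near \<open>v\<close> makes \<open>F(x) = \<Phi>(x) - \<Phi>(g) - \<langle>v, x - g\<rangle>\<close> coercive.  By strict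
  convexity \<open>g\<close> is its only zero, so its minimum over a half-space \<open>\<langle>h, x - g\<rangle> \<ge> c > 0\<close> is positive;
  this bounds the slope of the conjugate at \<open>v\<close> in direction \<open>h\<close> from above by \<open>\<langle>h, g\<rangle> + c\<close>.
\<close>

section \<open>Minima of coercive convex functions\<close>

text \<open>The exact deficit \<open>t * (1 - t) * (norm (x - y))\<^sup>2\<close> is kept, since at
  \<open>t = 1/2\<close> it bounds the distance of two almost norm-minimal points.\<close>

lemma norm_convex_combination_square:
  fixes x y :: "'a::real_inner" and t :: real
  shows "(norm ((1 - t) *\<^sub>R x + t *\<^sub>R y))\<^sup>2 =
    (1 - t) * (norm x)\<^sup>2 + t * (norm y)\<^sup>2 - t * (1 - t) * (norm (x - y))\<^sup>2"
  by (simp add: power2_norm_eq_inner inner_add_left inner_add_right inner_diff_left inner_diff_right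
      inner_commute[of y x] algebra_simps)

lemma convex_on_norm_diff_square:
  fixes g :: "'a::real_inner"
  shows "convex_on UNIV (\<lambda>x. (norm (x - g))\<^sup>2)"
proof (rule convex_onI)
  fix t :: real and x y :: 'a
  assume t: "0 < t" "t < 1"
  have "(1 - t) *\<^sub>R x + t *\<^sub>R y - g = (1 - t) *\<^sub>R (x - g) + t *\<^sub>R (y - g)"
    by (simp add: algebra_simps)
  then show "(norm ((1 - t) *\<^sub>R x + t *\<^sub>R y - g))\<^sup>2 \<le> (1 - t) * (norm (x - g))\<^sup>2 + t * (norm (y - g))\<^sup>2"
    using t by (simp add: norm_convex_combination_square)
qed simp

text \<open>
  Replaces weak compactness of bounded closed convex sets; almost norm-minimal points of the \<open>S n\<close>
  form a Cauchy sequence.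
\<close>

lemma nested_convex_Inter_nonempty:
  fixes S :: "nat \<Rightarrow> 'a::{real_inner,complete_space} set"
  assumes dec: "decseq S" and closed: "\<And>n. closed (S n)" and convex: "\<And>n. convex (S n)"
    and nonempty: "\<And>n. S n \<noteq> {}" and bounded: "bounded (S 0)"
  shows "(\<Inter>n. S n) \<noteq> {}"
proof -
  define d where "d n = (INF x\<in>S n. norm x)" for n
  have bdd: "bdd_below (norm ` S n)" for n
    by (auto intro: bdd_belowI[of _ 0])
  have d_le: "d n \<le> norm x" if "x \<in> S n" for n x
    unfolding d_def using bdd that by (rule cINF_lower)
  have d_mono: "d m \<le> d n" if "m \<le> n" for m n
    unfolding d_def using dec that nonempty bdd
    by (intro cINF_superset_mono) (auto simp: decseq_def)
  obtain B where B: "\<And>x. x \<in> S 0 \<Longrightarrow> norm x \<le> B"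
    using bounded unfolding bounded_iff by auto
  have dB: "d n \<le> B" for n
  proof -
    obtain x where "x \<in> S n" using nonempty by blast
    moreover have "S n \<subseteq> S 0" using dec by (auto simp: decseq_def)
    ultimately show ?thesis using d_le[of x n] B[of x] by auto
  qed
  obtain L where L: "d \<longlonglongrightarrow> L" and dL: "\<And>n. d n \<le> L"
    using incseq_convergent[of d B] d_mono dB by (auto simp: incseq_def)
  have ex: "\<exists>x\<in>S n. norm x < L + inverse (real (Suc n))" for n
  proof -
    have "d n < L + inverse (real (Suc n))" using dL[of n] by (smt (verit) inverse_positive_iff_positive of_nat_0_less_iff zero_less_Suc)
    then show ?thesis unfolding d_def using cINF_less_iff[OF nonempty bdd] by blast
  qed
  then obtain x where x: "\<And>n. x n \<in> S n" "\<And>n. norm (x n) < L + inverse (real (Suc n))"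
    by metis
  have x_in: "x m \<in> S n" if "n \<le> m" for m n
    using x(1)[of m] dec that by (auto simp: decseq_def)
  \<comment> \<open>Bound on squared distances in the tail from \<open>n\<close> on. The norms there
    are at most \<open>L + inverse (real (Suc n))\<close>, midpoints stay in \<open>S n\<close> and
    have norm at least \<open>d n\<close>, and the deficit at \<open>t = 1/2\<close> carries the
    factor 1/4.\<close>
  define e where "e n = 4 * ((L + inverse (real (Suc n)))\<^sup>2 - (d n)\<^sup>2)" for n
  have d_ge0: "0 \<le> d n" for n
    unfolding d_def using nonempty by (intro cINF_greatest) auto
  have near: "(norm (x m - x n))\<^sup>2 \<le> e N" if "N \<le> m" "N \<le> n" for m n N
  proof -
    have up: "(norm (x k))\<^sup>2 \<le> (L + inverse (real (Suc N)))\<^sup>2" if "N \<le> k" for k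
    proof (rule power_mono)
      have "inverse (real (Suc k)) \<le> inverse (real (Suc N))" using that by simp
      then show "norm (x k) \<le> L + inverse (real (Suc N))" using x(2)[of k] by linarith
    qed simp
    have "(1 - 1/2) *\<^sub>R x m + (1/2) *\<^sub>R x n \<in> S N"
      using convexD[OF convex[of N] x_in x_in, of m n "1 - 1/2" "1/2"] that by simp
    then have "(d N)\<^sup>2 \<le> (norm ((1 - 1/2) *\<^sub>R x m + (1/2) *\<^sub>R x n))\<^sup>2"
      using d_le d_ge0 by (intro power_mono) auto
    then show ?thesis
      unfolding norm_convex_combination_square e_def using up[OF that(1)] up[OF that(2)] by simp
  qed
  have "(\<lambda>n. 4 * ((L + inverse (real (Suc n)))\<^sup>2 - (d n)\<^sup>2)) \<longlonglongrightarrow> 4 * ((L + 0)\<^sup>2 - L\<^sup>2)"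
    by (intro tendsto_intros L LIMSEQ_inverse_real_of_nat)
  then have e0: "e \<longlonglongrightarrow> 0" unfolding e_def[abs_def] by simp
  have "Cauchy x"
  proof (rule metric_CauchyI)
    fix r :: real assume "0 < r"
    then have "eventually (\<lambda>n. e n < r\<^sup>2) sequentially"
      using e0 by (intro order_tendstoD) auto
    then obtain N where "e N < r\<^sup>2" by (auto simp: eventually_sequentially)
    then have "norm (x m - x n) < r" if "N \<le> m" "N \<le> n" for m n
      using near[OF that] \<open>0 < r\<close> by (intro power2_less_imp_less[of _ r]) auto
    then show "\<exists>N. \<forall>m\<ge>N. \<forall>n\<ge>N. dist (x m) (x n) < r" by (auto simp: dist_norm)
  qed
  then obtain l where l: "x \<longlonglongrightarrow> l" using Cauchy_convergent convergent_def by blast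
  have "l \<in> S n" for n
  proof (rule closed_sequentially[OF closed])
    show "x (k + n) \<in> S n" for k by (rule x_in) simp
    show "(\<lambda>k. x (k + n)) \<longlonglongrightarrow> l" using l by (rule LIMSEQ_ignore_initial_segment)
  qed
  then show ?thesis by blast
qed

section \<open>Convex functions with closed epigraph\<close>

lemma convex_on_sublevel:
  assumes "convex_on S J"
  shows "convex {x\<in>S. J x \<le> a}"
proof -
  have *: "J (u *\<^sub>R x + v *\<^sub>R y) \<le> a"
    if "x \<in> S" "y \<in> S" "J x \<le> a" "J y \<le> a" "0 \<le> u" "0 \<le> v" "u + v = 1" for x y u v
  proof -
    have "J (u *\<^sub>R x + v *\<^sub>R y) \<le> u * J x + v * J y"
      using assms that by (auto simp: convex_on_def)
    also have "\<dots> \<le> a" using that by (intro convex_bound_le) auto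
    finally show ?thesis .
  qed
  show ?thesis using assms unfolding convex_on_def convex_def by (auto intro: *)
qed

text \<open>A closed epigraph over \<open>S\<close> expresses lower semicontinuity of
  \<open>J\<close> extended by infinity outside \<open>S\<close>, without asking that
  \<open>S\<close> be closed. A sublevel set is a horizontal slice of it.\<close>

lemma closed_sublevel_of_closed_epigraph:
  fixes J :: "'a::topological_space \<Rightarrow> real"
  assumes "closed (epigraph S J)"
  shows "closed {x\<in>S. J x \<le> a}"
proof -
  have "closed ((\<lambda>x. (x, a)) -` epigraph S J)"
    by (intro closed_vimage assms continuous_intros)
  then show ?thesis by (simp add: vimage_def mem_epigraph)
qed

text \<open>The continuous shear sending \<open>(x, r)\<close> to \<open>(x, r - k x)\<close> pulls
  the epigraph of \<open>J\<close> back to that of the sum.\<close>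

lemma closed_epigraph_add:
  fixes J k :: "'a::topological_space \<Rightarrow> real"
  assumes "closed (epigraph S J)" "continuous_on UNIV k"
  shows "closed (epigraph S (\<lambda>x. J x + k x))"
proof -
  have "closed ((\<lambda>z. (fst z, snd z - k (fst z))) -` epigraph S J)"
    by (intro closed_vimage assms continuous_intros continuous_on_compose2[OF assms(2)]) auto
  also have "(\<lambda>z. (fst z, snd z - k (fst z))) -` epigraph S J = epigraph S (\<lambda>x. J x + k x)"
    by (auto simp: epigraph_def)
  finally show ?thesis .
qed

lemma closed_epigraph_Int:
  fixes J :: "'a::topological_space \<Rightarrow> real"
  assumes "closed (epigraph S J)" "closed T"
  shows "closed (epigraph (S \<inter> T) J)"
proof -
  have "epigraph (S \<inter> T) J = epigraph S J \<inter> fst -` T"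
    by (auto simp: epigraph_def)
  then show ?thesis
    using assms by (simp add: closed_Int closed_vimage_fst)
qed

text \<open>Direct method: the sublevel sets at heights decreasing to the infimum are nested,
  nonempty, closed, convex and bounded, and any common point is a minimiser.\<close>

lemma convex_coercive_attains_min:
  fixes J :: "'a::{real_inner,complete_space} \<Rightarrow> real"
  assumes "convex_on S J" "closed (epigraph S J)" "S \<noteq> {}"
    and "\<And>a. bounded {x\<in>S. J x \<le> a}" and bdd: "bdd_below (J ` S)"
  obtains x where "x \<in> S" "\<And>y. y \<in> S \<Longrightarrow> J x \<le> J y"
proof -
  define I where "I = (INF x\<in>S. J x)"
  define A where "A n = {x\<in>S. J x \<le> I + inverse (real (Suc n))}" for n
  have "(\<Inter>n. A n) \<noteq> {}"
  proof (rule nested_convex_Inter_nonempty)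
    have "A n \<subseteq> A m" if "m \<le> n" for m n
    proof -
      have "inverse (real (Suc n)) \<le> inverse (real (Suc m))" using that by simp
      then show ?thesis unfolding A_def by (auto intro: order_trans)
    qed
    then show "decseq A" by (simp add: decseq_def)
    show "closed (A n)" for n
      unfolding A_def by (rule closed_sublevel_of_closed_epigraph[OF assms(2)])
    show "convex (A n)" for n
      unfolding A_def by (rule convex_on_sublevel[OF assms(1)])
    show "bounded (A 0)" unfolding A_def by (rule assms)
    show "A n \<noteq> {}" for n
    proof -
      have "I < I + inverse (real (Suc n))" by simp
      then obtain x where "x \<in> S" "J x < I + inverse (real (Suc n))"
        unfolding I_def using cINF_less_iff[OF assms(3) bdd] by blast
      then show ?thesis by (auto simp: A_def intro: less_imp_le)
    qed
  qed
  then obtain x where x: "\<And>n. x \<in> A n" by blast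
  have "J x \<le> I"
  proof (rule LIMSEQ_le_const)
    have "(\<lambda>n. I + inverse (real (Suc n))) \<longlonglongrightarrow> I + 0"
      by (intro tendsto_intros LIMSEQ_inverse_real_of_nat)
    then show "(\<lambda>n. I + inverse (real (Suc n))) \<longlonglongrightarrow> I" by simp
    show "\<exists>N. \<forall>n\<ge>N. J x \<le> I + inverse (real (Suc n))" using x by (auto simp: A_def)
  qed
  moreover have "I \<le> J y" if "y \<in> S" for y
    unfolding I_def using bdd that by (rule cINF_lower)
  moreover have "x \<in> S" using x by (auto simp: A_def)
  ultimately show ?thesis using that by (meson order_trans)
qed

section \<open>Boundedness and slope of the conjugate\<close>

lemma convex_on_inner_right: "convex_on UNIV (\<lambda>x. inner u x)"
  by (rule convex_onI) (auto simp: inner_add_right)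

lemma proximal_point:
  fixes \<phi> :: "'a::{real_inner,complete_space} \<Rightarrow> real"
  assumes conv: "convex_on C \<phi>" and closed: "closed (epigraph C \<phi>)" and g: "g \<in> C"
    and sub: "\<And>x. x \<in> C \<Longrightarrow> \<phi> g + inner v (x - g) \<le> \<phi> x" and \<epsilon>: "0 < \<epsilon>"
  obtains x where "x \<in> C" "\<And>y. y \<in> C \<Longrightarrow> \<phi> x + inner (u - \<epsilon> *\<^sub>R (x - g)) (y - x) \<le> \<phi> y"
proof -
  \<comment> \<open>The quadratic term absorbs the linear one, \<open>d N \<le> \<epsilon>/4 N\<^sup>2 + d\<^sup>2/\<epsilon>\<close>, which leaves \<open>\<epsilon>/4 N\<^sup>2\<close> for coercivity.\<close>
  define J where "J x = \<phi> x + (inner (- u) x + \<epsilon> / 2 * (norm (x - g))\<^sup>2)" for x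
  define d where "d = norm (v - u)"
  define K where "K = \<phi> g - inner u g - d\<^sup>2 / \<epsilon>"
  have J_ge: "K + \<epsilon> / 4 * (norm (x - g))\<^sup>2 \<le> J x" if "x \<in> C" for x
  proof -
    define N where "N = norm (x - g)"
    have "0 \<le> (\<epsilon> / 2 * N - d)\<^sup>2 / \<epsilon>" using \<epsilon> by simp
    also have "\<dots> = \<epsilon> / 4 * N\<^sup>2 - d * N + d\<^sup>2 / \<epsilon>"
      using \<epsilon> by (simp add: power2_eq_square field_simps)
    finally have 1: "d * N \<le> \<epsilon> / 4 * N\<^sup>2 + d\<^sup>2 / \<epsilon>" by simp
    have 2: "- (d * N) \<le> inner (v - u) (x - g)"
      unfolding d_def N_def using Cauchy_Schwarz_ineq2[of "v - u" "x - g"] by (simp add: abs_le_iff)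
    have "J x \<ge> \<phi> g - inner u g + inner (v - u) (x - g) + \<epsilon> / 2 * N\<^sup>2"
      using sub[OF that] by (simp add: J_def N_def inner_diff_left inner_diff_right)
    then show ?thesis using 1 2 unfolding K_def N_def by linarith
  qed
  have convJ: "convex_on C J"
    unfolding J_def using \<epsilon>
    by (intro convex_on_add conv convex_on_cmul convex_on_subset[OF convex_on_inner_right]
        convex_on_subset[OF convex_on_norm_diff_square] convex_on_imp_convex[OF conv]) auto
  have closedJ: "closed (epigraph C J)"
    unfolding J_def by (intro closed_epigraph_add closed continuous_intros)
  have bddJ: "bdd_below (J ` C)"
    by (rule bdd_belowI[of _ K]) (use J_ge \<epsilon> in \<open>smt (verit) imageE mult_nonneg_nonneg divide_nonneg_pos zero_le_power2\<close>)
  have "bounded {x\<in>C. J x \<le> a}" for a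
  proof -
    have "norm (x - g) \<le> 1 + 4 / \<epsilon> * (a - K)" if "x \<in> C" "J x \<le> a" for x
    proof -
      have "\<epsilon> / 4 * (norm (x - g))\<^sup>2 \<le> a - K" using J_ge[OF that(1)] that(2) by linarith
      then have "(norm (x - g))\<^sup>2 \<le> 4 / \<epsilon> * (a - K)" using \<epsilon> by (simp add: field_simps)
      moreover have "norm (x - g) \<le> 1 + (norm (x - g))\<^sup>2"
        using sum_power2_ge_zero[of "norm (x - g) - 1/2" 0] by (simp add: power2_eq_square algebra_simps)
      ultimately show ?thesis by linarith
    qed
    then have "{x\<in>C. J x \<le> a} \<subseteq> cball g (1 + 4 / \<epsilon> * (a - K))"
      by (auto simp: dist_norm norm_minus_commute)
    then show ?thesis using bounded_cball bounded_subset by blast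
  qed
  then obtain x where x: "x \<in> C" "\<And>y. y \<in> C \<Longrightarrow> J x \<le> J y"
    using convex_coercive_attains_min[OF convJ closedJ _ _ bddJ] g by blast
  have "\<phi> x + inner (u - \<epsilon> *\<^sub>R (x - g)) (y - x) \<le> \<phi> y" if y: "y \<in> C" for y
  proof -
    \<comment> \<open>Minimality of \<open>x\<close> is tested along the segment towards
      \<open>y\<close>: at parameter \<open>s\<close> the increment of \<open>J\<close> is at most
      \<open>s * (A + s * B)\<close>. Dividing by \<open>s\<close> and letting it tend to 0 removes
      the quadratic remainder and leaves \<open>0 \<le> A\<close>, which is the claim.\<close>
    define A where "A = \<phi> y - \<phi> x - inner (u - \<epsilon> *\<^sub>R (x - g)) (y - x)"
    define B where "B = \<epsilon> / 2 * (norm (y - x))\<^sup>2"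
    have AB: "0 \<le> A + s * B" if s: "0 < s" "s < 1" for s
    proof -
      define z where "z = (1 - s) *\<^sub>R x + s *\<^sub>R y"
      have "z \<in> C" unfolding z_def
        using convex_on_imp_convex[OF conv] x(1) y s by (auto simp: convex_alt)
      then have "J x \<le> J z" by (rule x)
      moreover have "\<phi> z \<le> (1 - s) * \<phi> x + s * \<phi> y"
        unfolding z_def using s x(1) y by (intro convex_onD[OF conv]) auto
      moreover have "inner (- u) z = inner (- u) x - s * inner u (y - x)"
        unfolding z_def by (simp add: inner_add_right inner_diff_right algebra_simps)
      moreover have "(norm (z - g))\<^sup>2 = (norm (x - g))\<^sup>2 + 2 * s * inner (x - g) (y - x) + s\<^sup>2 * (norm (y - x))\<^sup>2"
      proof -
        have *: "z - g = (x - g) + s *\<^sub>R (y - x)" unfolding z_def by (simp add: algebra_simps)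
        show ?thesis
          unfolding power2_norm_eq_inner *
          by (simp add: inner_add_left inner_add_right inner_commute[of "y - x" "x - g"] power2_eq_square
              distrib_left)
      qed
      ultimately have "\<phi> x + \<epsilon> / 2 * (norm (x - g))\<^sup>2 \<le> (1 - s) * \<phi> x + s * \<phi> y - s * inner u (y - x)
         + \<epsilon> / 2 * ((norm (x - g))\<^sup>2 + 2 * s * inner (x - g) (y - x) + s\<^sup>2 * (norm (y - x))\<^sup>2)"
        unfolding J_def by simp
      then have "0 \<le> s * (A + s * B)"
        unfolding A_def B_def by (simp add: inner_diff_left power2_eq_square algebra_simps)
      then show ?thesis using s by (simp add: zero_le_mult_iff)
    qed
    have "((\<lambda>s. A + s * B) \<longlongrightarrow> A + 0 * B) (at_right 0)"
      by (intro tendsto_intros)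
    moreover have "\<forall>\<^sub>F s in at_right (0::real). 0 \<le> A + s * B"
      using AB by (auto simp: eventually_at_right_field intro!: exI[of _ 1])
    ultimately have "0 \<le> A + 0 * B" by (rule tendsto_lowerbound) simp
    then show ?thesis by (simp add: A_def)
  qed
  then show ?thesis using that x(1) by blast
qed

text \<open>\<open>bd\<close> spells out that the inverse subdifferential is bounded on
  \<open>U\<close>. The conclusion bounds, uniformly near \<open>v\<close>, the terms whose supremum
  is the conjugate.\<close>

lemma conjugate_locally_bounded:
  fixes \<phi> :: "'a::{real_inner,complete_space} \<Rightarrow> real"
  assumes conv: "convex_on C \<phi>" and closed: "closed (epigraph C \<phi>)" and g: "g \<in> C"
    and sub: "\<And>x. x \<in> C \<Longrightarrow> \<phi> g + inner v (x - g) \<le> \<phi> x"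
    and U: "open U" "v \<in> U"
    and bd: "\<And>w x. \<lbrakk>w \<in> U; x \<in> C; \<And>y. y \<in> C \<Longrightarrow> \<phi> x + inner w (y - x) \<le> \<phi> y\<rbrakk> \<Longrightarrow> norm x \<le> M"
  obtains \<delta> K where "0 < \<delta>" "\<And>u y. \<lbrakk>norm (u - v) \<le> \<delta>; y \<in> C\<rbrakk> \<Longrightarrow> inner u y - \<phi> y \<le> K"
proof -
  obtain r where r: "0 < r" "ball v r \<subseteq> U" using U open_contains_ball by blast
  have gM: "norm g \<le> M" using bd[OF U(2) g] sub by simp
  \<comment> \<open>The proximal subgradient \<open>w\<close> will lie within
    \<open>2 * \<delta>\<close> of \<open>v\<close>, hence inside \<open>ball v r\<close>.\<close>
  define \<delta> where "\<delta> = r / 3"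
  \<comment> \<open>Chaining the subgradient inequalities at \<open>x\<close> (with
    \<open>w\<close>) and at \<open>g\<close> (with \<open>v\<close>) gives \<open>inner w y -
    \<phi> y \<le> inner (w - v) x - \<phi> g + inner v g\<close>, and the first term is at most
    \<open>2 * \<delta> * M\<close>.\<close>
  define K where "K = 2 * \<delta> * M - \<phi> g + inner v g"
  have "inner u y - \<phi> y \<le> K" if u: "norm (u - v) \<le> \<delta>" and y: "y \<in> C" for u y
  proof -
    have step: "inner u y - \<phi> y \<le> K + \<epsilon> * ((2 * M) * norm y)" if \<epsilon>: "0 < \<epsilon>" for \<epsilon>
    proof -
      obtain x where x: "x \<in> C"
        and subx: "\<And>y. y \<in> C \<Longrightarrow> \<phi> x + inner (u - \<epsilon> *\<^sub>R (x - g)) (y - x) \<le> \<phi> y"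
        using proximal_point[OF conv closed g sub \<epsilon>] by blast
      define w where "w = u - \<epsilon> *\<^sub>R (x - g)"
      \<comment> \<open>Monotonicity of the subdifferential, by adding the inequalities at
        \<open>x\<close> and \<open>g\<close>. Expanding \<open>w\<close> then bounds
        \<open>\<epsilon> * norm (x - g)\<close> by \<open>norm (u - v)\<close>, whatever \<epsilon>
        is.\<close>
      have "0 \<le> inner (w - v) (x - g)"
        using subx[OF g] sub[OF x] unfolding w_def[symmetric]
        by (simp add: inner_diff_left inner_diff_right)
      also have "\<dots> = inner (u - v) (x - g) - \<epsilon> * (norm (x - g))\<^sup>2"
        unfolding w_def power2_norm_eq_inner by (simp add: inner_diff_left inner_diff_right algebra_simps)
      finally have "\<epsilon> * (norm (x - g))\<^sup>2 \<le> norm (u - v) * norm (x - g)"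
        using norm_cauchy_schwarz[of "u - v" "x - g"] by linarith
      then have en: "\<epsilon> * norm (x - g) \<le> norm (u - v)"
        by (cases "x = g") (simp_all add: power2_eq_square)
      have wv: "norm (w - v) \<le> 2 * \<delta>"
        unfolding w_def diff_diff_eq add.commute[of _ v] unfolding diff_diff_eq[symmetric]
        using en u norm_triangle_ineq4[of "u - v" "\<epsilon> *\<^sub>R (x - g)"] \<epsilon> by simp
      then have "w \<in> U" using r by (auto simp: \<delta>_def dist_norm norm_minus_commute subset_iff)
      then have xM: "norm x \<le> M" using bd x subx by (simp add: w_def)
      have "inner (w - v) x \<le> 2 * \<delta> * M"
        by (rule order_trans[OF norm_cauchy_schwarz]) (intro mult_mono wv xM; use wv r \<delta>_def in simp)
      then have 1: "inner w y - \<phi> y \<le> K"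
        using subx[OF y] sub[OF x] unfolding w_def[symmetric] K_def
        by (simp add: inner_diff_left inner_diff_right)
      \<comment> \<open>The price of replacing \<open>w\<close> by \<open>u\<close>: for fixed
        \<open>y\<close> the error is linear in \<epsilon>, because \<open>norm (x - g)\<close> is
        bounded independently of \<epsilon>.\<close>
      have "inner (x - g) y \<le> (2 * M) * norm y"
        by (rule order_trans[OF norm_cauchy_schwarz])
          (use gM xM norm_triangle_ineq4[of x g] in \<open>intro mult_right_mono; simp\<close>)
      then have "\<epsilon> * inner (x - g) y \<le> \<epsilon> * ((2 * M) * norm y)" using \<epsilon> by simp
      then show ?thesis using 1 by (simp add: w_def inner_diff_left)
    qed
    have "((\<lambda>\<epsilon>. K + \<epsilon> * ((2 * M) * norm y)) \<longlongrightarrow> K + 0 * ((2 * M) * norm y)) (at_right 0)"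
      by (intro tendsto_intros)
    moreover have "\<forall>\<^sub>F \<epsilon> in at_right (0::real). inner u y - \<phi> y \<le> K + \<epsilon> * ((2 * M) * norm y)"
      using step by (auto simp: eventually_at_right_field intro!: exI[of _ 1])
    ultimately have "inner u y - \<phi> y \<le> K + 0 * ((2 * M) * norm y)"
      by (rule tendsto_lowerbound) simp
    then show ?thesis by simp
  qed
  then show ?thesis using that[of \<delta> K] r by (simp add: \<delta>_def)
qed

text \<open>Attainment makes the strict inequality uniform: \<open>J\<close> has a minimiser on the
  half-space part of \<open>C\<close>, it differs from \<open>g\<close> because
  \<open>0 < c\<close>, and its excess \<open>J x - J g\<close> serves as \<eta>. Coercivity comes
  from \<open>bd\<close>.\<close>

lemma halfspace_gap:
  fixes \<phi> :: "'a::{real_inner,complete_space} \<Rightarrow> real"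
  assumes conv: "convex_on C \<phi>" and closed: "closed (epigraph C \<phi>)"
    and sub: "\<And>x. \<lbrakk>x \<in> C; x \<noteq> g\<rbrakk> \<Longrightarrow> \<phi> g + inner v (x - g) < \<phi> x"
    and \<delta>: "0 < \<delta>" and bd: "\<And>u y. \<lbrakk>norm (u - v) \<le> \<delta>; y \<in> C\<rbrakk> \<Longrightarrow> inner u y - \<phi> y \<le> K"
    and c: "0 < c"
  obtains \<eta> where "0 < \<eta>"
    "\<And>x. \<lbrakk>x \<in> C; c \<le> inner h (x - g)\<rbrakk> \<Longrightarrow> \<phi> g + inner v (x - g) + \<eta> \<le> \<phi> x"
proof (cases "C \<inter> {x. c + inner h g \<le> inner h x} = {}")
  case True
  then show ?thesis using that[of 1] by (force simp: inner_diff_right)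
next
  case False
  define H where "H = C \<inter> {x. c + inner h g \<le> inner h x}"
  define J where "J x = \<phi> x + inner (- v) x" for x
  have "closed {x. c + inner h g \<le> inner h x}"
    by (intro closed_Collect_le continuous_intros)
  then have closedJ: "closed (epigraph H J)"
    unfolding J_def H_def
    by (intro closed_epigraph_add closed_epigraph_Int closed continuous_intros)
  have "convex H"
    unfolding H_def using convex_halfspace_ge[of "c + inner h g" h]
    by (intro convex_Int convex_on_imp_convex[OF conv]) (simp add: inner_commute)
  then have convJ: "convex_on H J"
    unfolding J_def
    by (intro convex_on_add convex_on_subset[OF conv] convex_on_subset[OF convex_on_inner_right])
      (auto simp: H_def)
  have coercive: "\<delta> * norm y - K \<le> J y" if "y \<in> C" for y
  proof -
    \<comment> \<open>The bound is tested at the point of the \<delta>-ball about \<open>v\<close>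
      furthest in direction \<open>y\<close>. For \<open>y = 0\<close> the added vector is 0, so no
      case split is required.\<close>
    have "inner (v + (\<delta> / norm y) *\<^sub>R y) y - \<phi> y \<le> K"
      using \<delta> by (intro bd that) auto
    moreover have "(\<delta> / norm y) * inner y y = \<delta> * norm y"
      by (simp add: power2_norm_eq_inner[symmetric] power2_eq_square)
    ultimately show ?thesis by (simp add: J_def inner_add_left)
  qed
  have bddJ: "bdd_below (J ` H)"
  proof (rule bdd_belowI2)
    fix y assume "y \<in> H"
    then have "\<delta> * norm y - K \<le> J y" by (intro coercive) (simp add: H_def)
    moreover have "0 \<le> \<delta> * norm y" using \<delta> by simp
    ultimately show "- K \<le> J y" by linarith
  qed
  have "bounded {x\<in>H. J x \<le> a}" for a
    unfolding bounded_iff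
  proof (intro exI ballI)
    fix x assume "x \<in> {x\<in>H. J x \<le> a}"
    then have "\<delta> * norm x \<le> a + K" using coercive[of x] by (auto simp: H_def)
    then show "norm x \<le> (a + K) / \<delta>" using \<delta> by (simp add: field_simps)
  qed
  then obtain x where x: "x \<in> H" "\<And>y. y \<in> H \<Longrightarrow> J x \<le> J y"
    using convex_coercive_attains_min[OF convJ closedJ _ _ bddJ] False by (auto simp: H_def[symmetric])
  have "x \<in> C" "x \<noteq> g" using x(1) c by (auto simp: H_def)
  then have "0 < J x - J g" using sub[of x] by (simp add: J_def inner_diff_right)
  moreover have "\<phi> g + inner v (y - g) + (J x - J g) \<le> \<phi> y"
    if "y \<in> C" "c \<le> inner h (y - g)" for y
    using x(2)[of y] that by (simp add: H_def J_def inner_diff_right)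
  ultimately show ?thesis using that by blast
qed

text \<open>With \<open>F\<close> the excess of \<phi> over its tangent at \<open>g\<close>, the
  claim reads \<open>t * inner h (x - g) - F x \<le> t * c\<close>. Where
  \<open>inner h (x - g) \<le> c\<close> it follows from \<open>0 \<le> F x\<close>; beyond,
  \<open>F\<close> grows at least at rate \<open>\<eta> / c\<close> in
  \<open>inner h (x - g)\<close>, which dictates the range of \<open>t\<close>.\<close>

lemma conjugate_upper_slope:
  fixes \<phi> :: "'a::{real_inner,complete_space} \<Rightarrow> real"
  assumes conv: "convex_on C \<phi>" and closed: "closed (epigraph C \<phi>)" and g: "g \<in> C"
    and sub: "\<And>x. \<lbrakk>x \<in> C; x \<noteq> g\<rbrakk> \<Longrightarrow> \<phi> g + inner v (x - g) < \<phi> x"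
    and \<delta>: "0 < \<delta>" and bd: "\<And>u y. \<lbrakk>norm (u - v) \<le> \<delta>; y \<in> C\<rbrakk> \<Longrightarrow> inner u y - \<phi> y \<le> K"
    and c: "0 < c"
  obtains \<tau> where "0 < \<tau>"
    "\<And>t x. \<lbrakk>0 \<le> t; t \<le> \<tau>; x \<in> C\<rbrakk> \<Longrightarrow>
      inner (v + t *\<^sub>R h) x - \<phi> x \<le> inner v g - \<phi> g + t * inner h g + t * c"
proof -
  obtain \<eta> where \<eta>: "0 < \<eta>"
    "\<And>x. \<lbrakk>x \<in> C; c \<le> inner h (x - g)\<rbrakk> \<Longrightarrow> \<phi> g + inner v (x - g) + \<eta> \<le> \<phi> x"
    using halfspace_gap[OF conv closed sub \<delta> bd c] by blast
  define F where "F x = \<phi> x - \<phi> g - inner v (x - g)" for x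
  have "t * inner h (x - g) - F x \<le> t * c" if t: "0 \<le> t" "t \<le> \<eta> / c" and x: "x \<in> C" for t x
  proof (cases "inner h (x - g) \<le> c")
    case True
    then have "t * inner h (x - g) \<le> t * c" using t by (intro mult_left_mono)
    moreover have "0 \<le> F x" using sub[OF x] unfolding F_def by (cases "x = g") auto
    ultimately show ?thesis by linarith
  next
    case False
    \<comment> \<open>\<open>F\<close> is convex and vanishes at \<open>g\<close>, so its value \<open>\<ge> \<eta>\<close> where the ray from \<open>g\<close> to \<open>x\<close> enters the
      half-space forces linear growth beyond.\<close>
    define s where "s = inner h (x - g)"
    have s: "c < s" using False by (simp add: s_def)
    define q where "q = c / s"
    have q: "0 < q" "q < 1" using s c by (auto simp: q_def)
    define z where "z = (1 - q) *\<^sub>R g + q *\<^sub>R x"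
    have zg: "z - g = q *\<^sub>R (x - g)" by (simp add: z_def algebra_simps)
    have "z \<in> C" unfolding z_def
      using convex_on_imp_convex[OF conv] g x q by (auto simp: convex_alt)
    moreover have "inner h (z - g) = c" unfolding zg using s c by (simp add: q_def s_def)
    ultimately have "\<eta> \<le> F z" using \<eta>(2)[of z] by (simp add: F_def)
    also have "\<dots> \<le> q * F x"
      using convex_onD[OF conv, of q g x] g x q
      unfolding F_def zg unfolding z_def by (simp add: algebra_simps)
    finally have "\<eta> / c * s \<le> F x" using s c by (simp add: q_def field_simps)
    moreover have "t * s \<le> \<eta> / c * s" using t s c by (intro mult_right_mono) auto
    ultimately have "t * s - F x \<le> 0" by linarith
    also have "\<dots> \<le> t * c" using t c by simp
    finally show ?thesis by (simp add: s_def)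
  qed
  then have "inner (v + t *\<^sub>R h) x - \<phi> x \<le> inner v g - \<phi> g + t * inner h g + t * c"
    if "0 \<le> t" "t \<le> \<eta> / c" "x \<in> C" for t x
    using that by (fastforce simp: F_def inner_add_left inner_diff_right algebra_simps)
  moreover have "0 < \<eta> / c" using \<eta>(1) c by simp
  ultimately show ?thesis using that by blast
qed

section \<open>Gradients and conjugates of extended-real functions\<close>

lemma has_frechet_gradient_imp_gateaux:
  assumes "has_frechet_gradient F x D"
  shows "has_gateaux_gradient F x D"
proof -
  let ?F = "\<lambda>y. real_of_ereal (F y)"
  have D: "(?F has_derivative (\<lambda>h. inner h D)) (at (x + 0 *\<^sub>R h))" for h
    using assms by (simp add: has_frechet_gradient_def gderiv_def)
  have "((\<lambda>t. ?F (x + t *\<^sub>R h)) has_real_derivative inner D h) (at 0)" for h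
  proof -
    have "((\<lambda>t. x + t *\<^sub>R h) has_derivative (\<lambda>t. t *\<^sub>R h)) (at 0)"
      by (auto intro!: derivative_eq_intros)
    from has_derivative_compose[OF this D] show ?thesis
      by (simp add: has_field_derivative_def inner_commute mult_commute_abs)
  qed
  then show ?thesis using assms by (simp add: has_gateaux_gradient_def has_frechet_gradient_def)
qed

lemma has_gateaux_gradient_unique:
  assumes "has_gateaux_gradient F x D" "has_gateaux_gradient F x E"
  shows "D = E"
proof -
  have "inner D h = inner E h" for h
    using assms DERIV_unique unfolding has_gateaux_gradient_def by blast
  then show ?thesis by (metis inner_commute vector_eq_rdot)
qed

lemma gateaux_gradient_eq: "has_gateaux_gradient F x D \<Longrightarrow> gateaux_gradient F x = D"
  unfolding gateaux_gradient_def by (blast intro: the_equality has_gateaux_gradient_unique)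

lemma frechet_gradient_eq: "has_frechet_gradient F x D \<Longrightarrow> frechet_gradient F x = D"
  unfolding frechet_gradient_def
  by (blast intro: the_equality has_gateaux_gradient_unique has_frechet_gradient_imp_gateaux)

lemma has_frechet_gradient_frechet_gradient:
  "frechet_differentiable_at F x \<Longrightarrow> has_frechet_gradient F x (frechet_gradient F x)"
  using frechet_gradient_eq unfolding frechet_differentiable_at_def by blast

section \<open>Passage from extended-real functions to real functions on the effective
  domain\<close>

lemma proper_eq_ereal_on_edom:
  assumes "proper F" "x \<in> edom F"
  shows "F x = ereal (real_of_ereal (F x))"
  using assms by (cases "F x") (auto simp: proper_def edom_def)

lemma strictly_convex_on_edom_realD:
  assumes F: "proper F" "strictly_convex_on (edom F) F"
    and xy: "x \<in> edom F" "y \<in> edom F" "x \<noteq> y" and t: "0 < t" "t < 1"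
  shows "(1 - t) *\<^sub>R x + t *\<^sub>R y \<in> edom F"
    and "real_of_ereal (F ((1 - t) *\<^sub>R x + t *\<^sub>R y))
      < (1 - t) * real_of_ereal (F x) + t * real_of_ereal (F y)"
proof -
  let ?z = "(1 - t) *\<^sub>R x + t *\<^sub>R y"
  have "F ?z < ereal (1 - t) * F x + ereal t * F y"
    using F(2) xy t unfolding strictly_convex_on_def by blast
  also have "\<dots> = ereal ((1 - t) * real_of_ereal (F x) + t * real_of_ereal (F y))"
    using proper_eq_ereal_on_edom[OF F(1) xy(1)] proper_eq_ereal_on_edom[OF F(1) xy(2)]
    by (metis plus_ereal.simps(1) times_ereal.simps(1))
  finally have less: "F ?z < ereal ((1 - t) * real_of_ereal (F x) + t * real_of_ereal (F y))" .
  then show z: "?z \<in> edom F" by (auto simp: edom_def)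
  show "real_of_ereal (F ?z) < (1 - t) * real_of_ereal (F x) + t * real_of_ereal (F y)"
    using less proper_eq_ereal_on_edom[OF F(1) z] by (metis less_ereal.simps(1))
qed

lemma convex_on_edom:
  assumes F: "proper F" "strictly_convex_on (edom F) F"
  shows "convex_on (edom F) (\<lambda>x. real_of_ereal (F x))"
proof -
  have *: "(1 - t) *\<^sub>R x + t *\<^sub>R y \<in> edom F \<and> real_of_ereal (F ((1 - t) *\<^sub>R x + t *\<^sub>R y))
      \<le> (1 - t) * real_of_ereal (F x) + t * real_of_ereal (F y)"
    if "x \<in> edom F" "y \<in> edom F" "0 \<le> t" "t \<le> 1" for x y t
  proof -
    consider "t = 0" | "t = 1" | "x = y" | "0 < t" "t < 1" "x \<noteq> y"
      using \<open>0 \<le> t\<close> \<open>t \<le> 1\<close> by linarith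
    then show ?thesis
    proof cases
      case 3
      then show ?thesis using that by (simp flip: scaleR_add_left distrib_right)
    next
      case 4
      then show ?thesis
        using strictly_convex_on_edom_realD[OF F that(1,2)] by (auto intro: less_imp_le)
    qed (use that in auto)
  qed
  show ?thesis
    by (rule convex_onI) (use * in \<open>auto simp: convex_alt intro: less_imp_le\<close>)
qed

text \<open>If the limit left the epigraph, a real \<open>b\<close> would separate its height from
  the function value above it. Lower semicontinuity keeps the values along the sequence above
  \<open>b\<close>, while the heights eventually fall below \<open>b\<close>.\<close>

lemma closed_epigraph_edom:
  fixes F :: "'a::metric_space \<Rightarrow> ereal"
  assumes F: "proper F" "lower_semicontinuous F"
  shows "closed (epigraph (edom F) (\<lambda>x. real_of_ereal (F x)))"
  unfolding closed_sequential_limits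
proof (intro allI impI, elim conjE)
  fix z :: "nat \<Rightarrow> 'a \<times> real" and l
  assume z: "\<forall>n. z n \<in> epigraph (edom F) (\<lambda>x. real_of_ereal (F x))" and l: "z \<longlonglongrightarrow> l"
  have le: "F (fst (z n)) \<le> ereal (snd (z n))" for n
  proof -
    have n: "fst (z n) \<in> edom F" "real_of_ereal (F (fst (z n))) \<le> snd (z n)"
      using z[rule_format, of n] by (auto simp: epigraph_def)
    then show ?thesis using proper_eq_ereal_on_edom[OF F(1) n(1)] by (metis ereal_less_eq(3))
  qed
  have "F (fst l) \<le> ereal (snd l)"
  proof (rule ccontr)
    assume "\<not> ?thesis"
    then obtain b where b: "ereal (snd l) < ereal b" "ereal b < F (fst l)"
      using ereal_dense2[of "ereal (snd l)" "F (fst l)"] by (auto simp: not_le)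
    have "\<forall>\<^sub>F n in sequentially. ereal b < F (fst (z n))"
      using F(2) b(2) tendsto_fst[OF l]
      unfolding lower_semicontinuous_def filterlim_def le_filter_def eventually_filtermap by blast
    moreover have "\<forall>\<^sub>F n in sequentially. snd (z n) < b"
      using order_tendstoD(2)[OF tendsto_snd[OF l]] b(1) by simp
    ultimately have "\<forall>\<^sub>F n in sequentially. False"
    proof eventually_elim
      case (elim n)
      then have "F (fst (z n)) < ereal b" using le[of n] by (meson ereal_less(2) le_less_trans less_ereal.simps(1))
      then show False using elim by simp
    qed
    then show False by simp
  qed
  moreover from this have "fst l \<in> edom F" by (auto simp: edom_def)
  ultimately show "l \<in> epigraph (edom F) (\<lambda>x. real_of_ereal (F x))"
    unfolding epigraph_def using proper_eq_ereal_on_edom[OF F(1)]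
    by (metis (mono_tags, lifting) ereal_less_eq(3) mem_Collect_eq)
qed

text \<open>Convexity bounds the difference quotients by \<open>?F y - ?F g\<close>, which in the
  limit gives only the weak inequality. Strictness comes from using it at the midpoint of
  \<open>g\<close> and \<open>x\<close>, where strict convexity leaves slack.\<close>

lemma strict_gradient_inequality:
  assumes F: "proper F" "strictly_convex_on (edom F) F"
    and D: "has_gateaux_gradient F g D" and x: "x \<in> edom F" "x \<noteq> g"
  shows "real_of_ereal (F g) + inner D (x - g) < real_of_ereal (F x)"
proof -
  let ?F = "\<lambda>x. real_of_ereal (F x)"
  have g: "g \<in> edom F" using D interior_subset by (auto simp: has_gateaux_gradient_def)
  have nonstrict: "?F g + inner D (y - g) \<le> ?F y" if y: "y \<in> edom F" for y
  proof -
    have "((\<lambda>t. ?F (g + t *\<^sub>R (y - g))) has_real_derivative inner D (y - g)) (at 0)"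
      using D by (simp add: has_gateaux_gradient_def)
    then have "((\<lambda>t. (?F (g + t *\<^sub>R (y - g)) - ?F g) / t) \<longlongrightarrow> inner D (y - g)) (at 0)"
      by (simp add: has_field_derivative_iff)
    then have lim: "((\<lambda>t. (?F (g + t *\<^sub>R (y - g)) - ?F g) / t) \<longlongrightarrow> inner D (y - g)) (at_right 0)"
      by (rule tendsto_mono[OF at_le, rotated]) simp
    have "(?F (g + t *\<^sub>R (y - g)) - ?F g) / t \<le> ?F y - ?F g" if t: "0 < t" "t < 1" for t
    proof -
      have "?F ((1 - t) *\<^sub>R g + t *\<^sub>R y) \<le> (1 - t) * ?F g + t * ?F y"
        using t g y by (intro convex_onD[OF convex_on_edom[OF F]]) auto
      moreover have "g + t *\<^sub>R (y - g) = (1 - t) *\<^sub>R g + t *\<^sub>R y" by (simp add: algebra_simps)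
      ultimately show ?thesis using t by (simp add: field_simps)
    qed
    then have "\<forall>\<^sub>F t in at_right (0::real). (?F (g + t *\<^sub>R (y - g)) - ?F g) / t \<le> ?F y - ?F g"
      by (auto simp: eventually_at_right_field intro!: exI[of _ 1])
    with lim have "inner D (y - g) \<le> ?F y - ?F g" by (rule tendsto_upperbound) simp
    then show ?thesis by simp
  qed
  define m where "m = (1 - 1/2) *\<^sub>R g + (1/2) *\<^sub>R x"
  have "?F m < (1 - 1/2) * ?F g + (1/2) * ?F x" and "m \<in> edom F"
    unfolding m_def using g x by (intro strictly_convex_on_edom_realD[OF F]; simp)+
  moreover have "m - g = (1/2) *\<^sub>R (x - g)" by (simp add: m_def algebra_simps flip: scaleR_add_left)
  ultimately show ?thesis using nonstrict[of m] by simp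
qed

section \<open>Values and Gateaux gradient of the conjugate\<close>

lemma conjugate_le_ereal_iff:
  assumes "proper F"
  shows "conjugate F u \<le> ereal r \<longleftrightarrow> (\<forall>y\<in>edom F. inner u y - real_of_ereal (F y) \<le> r)"
proof -
  have "ereal (inner u y) - F y \<le> ereal r \<longleftrightarrow> (y \<in> edom F \<longrightarrow> inner u y - real_of_ereal (F y) \<le> r)" for y
    using assms by (cases "F y") (auto simp: proper_def edom_def)
  then show ?thesis unfolding conjugate_def SUP_le_iff by auto
qed

lemma conjugate_ge:
  assumes "proper F" "y \<in> edom F"
  shows "ereal (inner u y - real_of_ereal (F y)) \<le> conjugate F u"
proof -
  have "ereal (inner u y - real_of_ereal (F y)) = ereal (inner u y) - F y"
    using proper_eq_ereal_on_edom[OF assms] by (metis ereal_minus(1))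
  also have "\<dots> \<le> conjugate F u" unfolding conjugate_def by (rule SUP_upper) simp
  finally show ?thesis .
qed

text \<open>Equality in Fenchel-Young: by the gradient inequality, \<open>g\<close> attains the
  supremum defining the conjugate at \<open>D\<close>.\<close>

lemma conjugate_at_gradient:
  assumes F: "proper F" "strictly_convex_on (edom F) F" and D: "has_gateaux_gradient F g D"
  shows "conjugate F D = ereal (inner D g - real_of_ereal (F g))"
proof (rule antisym)
  have "g \<in> edom F" using D interior_subset by (auto simp: has_gateaux_gradient_def)
  then show "ereal (inner D g - real_of_ereal (F g)) \<le> conjugate F D"
    by (rule conjugate_ge[OF F(1)])
  show "conjugate F D \<le> ereal (inner D g - real_of_ereal (F g))"
    unfolding conjugate_le_ereal_iff[OF F(1)]
  proof
    fix y assume "y \<in> edom F"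
    then show "inner D y - real_of_ereal (F y) \<le> inner D g - real_of_ereal (F g)"
      using strict_gradient_inequality[OF F D, of y] by (cases "y = g") (auto simp: inner_diff_right)
  qed
qed

lemma mem_subdifferential_iff_real:
  assumes "proper F"
  shows "u \<in> subdifferential F x \<longleftrightarrow> x \<in> edom F \<and>
    (\<forall>y\<in>edom F. real_of_ereal (F x) + inner u (y - x) \<le> real_of_ereal (F y))"
proof -
  have "F x + ereal (inner u (y - x)) \<le> F y \<longleftrightarrow>
      (y \<in> edom F \<longrightarrow> real_of_ereal (F x) + inner u (y - x) \<le> real_of_ereal (F y))"
    if "x \<in> edom F" for y
    using assms that by (cases "F y"; cases "F x") (auto simp: proper_def edom_def)
  then show ?thesis by (auto simp: subdifferential_def)
qed

text \<open>Along a fixed line through \<open>D\<close> the conjugate is squeezed between its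
  supporting line of slope \<open>inner g h\<close> and that line plus
  \<open>\<bar>t\<bar> * (r / 2)\<close>. The admissible range of \<open>t\<close> depends on
  \<open>h\<close>, so the argument yields a Gateaux and not a Frechet gradient.\<close>

lemma conjugate_has_gateaux_gradient:
  fixes F :: "'a::{real_inner,complete_space} \<Rightarrow> ereal"
  assumes F: "proper F" "strictly_convex_on (edom F) F" "lower_semicontinuous F"
    and lb: "locally_bounded_on_dom (op_inverse (subdifferential F))"
    and D: "has_gateaux_gradient F g D"
  shows "has_gateaux_gradient (conjugate F) D g"
proof -
  let ?F = "\<lambda>x. real_of_ereal (F x)"
  have g: "g \<in> edom F" using D interior_subset by (auto simp: has_gateaux_gradient_def)
  note conv = convex_on_edom[OF F(1,2)]
  note closed = closed_epigraph_edom[OF F(1,3)]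
  note strict = strict_gradient_inequality[OF F(1,2) D]
  have sub: "?F g + inner D (x - g) \<le> ?F x" if "x \<in> edom F" for x
    using strict[OF that] by (cases "x = g") auto
  have "D \<in> op_dom (op_inverse (subdifferential F))"
    using g sub by (auto simp: op_dom_def op_inverse_def mem_subdifferential_iff_real[OF F(1)])
  then obtain U where U: "open U" "D \<in> U"
      and bU: "bounded (\<Union>w\<in>U. op_inverse (subdifferential F) w)"
    using lb unfolding locally_bounded_on_dom_def by blast
  obtain M where M: "\<And>x. x \<in> (\<Union>w\<in>U. op_inverse (subdifferential F) w) \<Longrightarrow> norm x \<le> M"
    using bU unfolding bounded_iff by blast
  have bd: "norm x \<le> M"
    if "w \<in> U" "x \<in> edom F" "\<And>y. y \<in> edom F \<Longrightarrow> ?F x + inner w (y - x) \<le> ?F y" for w x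
    using that by (intro M) (auto simp: op_inverse_def mem_subdifferential_iff_real[OF F(1)])
  obtain \<delta> K where \<delta>: "0 < \<delta>"
    and K: "\<And>u y. \<lbrakk>norm (u - D) \<le> \<delta>; y \<in> edom F\<rbrakk> \<Longrightarrow> inner u y - ?F y \<le> K"
    using conjugate_locally_bounded[OF conv closed g sub U, of M] bd by blast
  have "cball D \<delta> \<subseteq> edom (conjugate F)"
  proof
    fix u assume "u \<in> cball D \<delta>"
    then have "conjugate F u \<le> ereal K"
      unfolding conjugate_le_ereal_iff[OF F(1)] using K
      by (auto simp: dist_norm norm_minus_commute)
    then show "u \<in> edom (conjugate F)" by (auto simp: edom_def)
  qed
  then have int: "D \<in> interior (edom (conjugate F))"
    using \<delta> by (meson ball_subset_cball centre_in_ball interior_maximal open_ball order_trans subset_eq)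
  define m where "m = inner D g - ?F g"
  have at_D: "conjugate F D = ereal m"
    unfolding m_def by (rule conjugate_at_gradient[OF F(1,2) D])
  have "((\<lambda>t. real_of_ereal (conjugate F (D + t *\<^sub>R h))) has_real_derivative inner g h) (at 0)" for h
    unfolding has_field_derivative_iff
  proof (rule LIM_I)
    fix r :: real assume r: "0 < r"
    have c: "0 < r / 2" using r by simp
    obtain \<tau>1 where \<tau>1: "0 < \<tau>1" and up1: "\<And>t x. \<lbrakk>0 \<le> t; t \<le> \<tau>1; x \<in> edom F\<rbrakk> \<Longrightarrow>
        inner (D + t *\<^sub>R h) x - ?F x \<le> inner D g - ?F g + t * inner h g + t * (r / 2)"
      using conjugate_upper_slope[OF conv closed g strict \<delta> K c] by blast
    obtain \<tau>2 where \<tau>2: "0 < \<tau>2" and up2: "\<And>t x. \<lbrakk>0 \<le> t; t \<le> \<tau>2; x \<in> edom F\<rbrakk> \<Longrightarrow>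
        inner (D + t *\<^sub>R (- h)) x - ?F x \<le> inner D g - ?F g + t * inner (- h) g + t * (r / 2)"
      using conjugate_upper_slope[OF conv closed g strict \<delta> K c] by blast
    have "norm ((real_of_ereal (conjugate F (D + t *\<^sub>R h)) - real_of_ereal (conjugate F (D + 0 *\<^sub>R h))) / (t - 0)
        - inner g h) < r"
      if t: "t \<noteq> 0" "norm (t - 0) < min \<tau>1 \<tau>2" for t
    proof -
      \<comment> \<open>Negative \<open>t\<close> is handled by the slope bound for
        \<open>- h\<close> at parameter \<open>- t\<close>.\<close>
      have up: "inner (D + t *\<^sub>R h) x - ?F x \<le> m + t * inner g h + \<bar>t\<bar> * (r / 2)" if "x \<in> edom F" for x
        using up1[of t x] up2[of "- t" x] t that
        by (cases "0 \<le> t") (auto simp: m_def inner_commute[of h g])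
      \<comment> \<open>The supporting line arises from testing the supremum at
        \<open>g\<close>.\<close>
      have low: "m + t * inner g h \<le> inner (D + t *\<^sub>R h) g - ?F g"
        by (simp add: m_def inner_add_left inner_commute[of h g])
      have "conjugate F (D + t *\<^sub>R h) \<le> ereal (m + t * inner g h + \<bar>t\<bar> * (r / 2))"
        unfolding conjugate_le_ereal_iff[OF F(1)] using up by blast
      moreover have "ereal (m + t * inner g h) \<le> conjugate F (D + t *\<^sub>R h)"
        using conjugate_ge[OF F(1) g, of "D + t *\<^sub>R h"] low by (meson ereal_less_eq(3) order_trans)
      ultimately obtain s where "conjugate F (D + t *\<^sub>R h) = ereal s"
          and s: "m + t * inner g h \<le> s" "s \<le> m + t * inner g h + \<bar>t\<bar> * (r / 2)"
        by (cases "conjugate F (D + t *\<^sub>R h)") auto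
      then have "norm ((real_of_ereal (conjugate F (D + t *\<^sub>R h)) - real_of_ereal (conjugate F (D + 0 *\<^sub>R h))) / (t - 0)
        - inner g h) = \<bar>(s - m - t * inner g h) / t\<bar>"
        using t(1) by (simp add: at_D diff_divide_distrib)
      also have "\<dots> = (s - m - t * inner g h) / \<bar>t\<bar>" using s by (simp add: abs_divide)
      also have "\<dots> \<le> r / 2" using s t(1) by (simp add: divide_le_eq mult.commute)
      also have "\<dots> < r" using r by simp
      finally show ?thesis .
    qed
    then show "\<exists>s>0. \<forall>t. t \<noteq> 0 \<and> norm (t - 0) < s \<longrightarrow>
        norm ((real_of_ereal (conjugate F (D + t *\<^sub>R h)) - real_of_ereal (conjugate F (D + 0 *\<^sub>R h))) / (t - 0)
        - inner g h) < r"
      using \<tau>1 \<tau>2 by (intro exI[of _ "min \<tau>1 \<tau>2"]) auto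
  qed
  then show ?thesis using int by (simp add: has_gateaux_gradient_def)
qed

text \<open>The Gateaux form holds unconditionally. The Frechet form is tied to existence of that
  gradient, which must then equal the Gateaux gradient \<open>g\<close>.\<close>

theorem theorem8:
  fixes \<Phi> :: "'a::{real_inner,complete_space} \<Rightarrow> ereal" and f g :: 'a
  assumes "legendre_generator \<Phi>"
    and "f \<in> interior (edom \<Phi>)" and "g \<in> interior (edom \<Phi>)"
  shows "(frechet_differentiable_at (conjugate \<Phi>) (frechet_gradient \<Phi> g) \<longrightarrow>
            bregman_div \<Phi> g f =
            bregman_div (conjugate \<Phi>) (frechet_gradient \<Phi> f) (frechet_gradient \<Phi> g))
       \<and> gateaux_differentiable_at (conjugate \<Phi>) (frechet_gradient \<Phi> g)
       \<and> bregman_div \<Phi> g f =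
            bregman_div_gateaux (conjugate \<Phi>) (frechet_gradient \<Phi> f) (frechet_gradient \<Phi> g)"
proof -
  have \<Phi>: "proper \<Phi>" "strictly_convex_on (edom \<Phi>) \<Phi>" "lower_semicontinuous \<Phi>"
    and lb: "locally_bounded_on_dom (op_inverse (subdifferential \<Phi>))"
    using assms(1) by (auto simp: legendre_generator_def generator_def essentially_strictly_convex_def)
  have grad: "has_gateaux_gradient \<Phi> x (frechet_gradient \<Phi> x)" if "x \<in> interior (edom \<Phi>)" for x
    using assms(1) that unfolding legendre_generator_def generator_def
    by (blast intro: has_frechet_gradient_imp_gateaux has_frechet_gradient_frechet_gradient)
  note conj = conjugate_at_gradient[OF \<Phi>(1,2) grad]
  have dual_grad: "has_gateaux_gradient (conjugate \<Phi>) (frechet_gradient \<Phi> g) g"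
    by (rule conjugate_has_gateaux_gradient[OF \<Phi> lb grad[OF assms(3)]])
  have val: "\<Phi> x = ereal (real_of_ereal (\<Phi> x))" if "x \<in> interior (edom \<Phi>)" for x
    using proper_eq_ereal_on_edom[OF \<Phi>(1)] that interior_subset by blast
  \<comment> \<open>Inserting the two Fenchel-Young equalities, the terms pairing
    \<open>frechet_gradient \<Phi> g\<close> with \<open>g\<close> cancel and the rest is the primal
    divergence. \<open>val\<close> exhibits the values of \<Phi> as finite, so that the cancellation
    takes place among reals.\<close>
  have duality: "bregman_div \<Phi> g f = conjugate \<Phi> (frechet_gradient \<Phi> f)
      - conjugate \<Phi> (frechet_gradient \<Phi> g)
      - ereal (inner g (frechet_gradient \<Phi> f - frechet_gradient \<Phi> g))"
    unfolding bregman_div_def conj[OF assms(2)] conj[OF assms(3)]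
    by (subst val[OF assms(2)], subst val[OF assms(3)]) (simp add: inner_diff_right inner_commute)
  have "frechet_gradient (conjugate \<Phi>) (frechet_gradient \<Phi> g) = g"
    if "frechet_differentiable_at (conjugate \<Phi>) (frechet_gradient \<Phi> g)"
    using that dual_grad
    by (blast intro: has_gateaux_gradient_unique has_frechet_gradient_imp_gateaux
        has_frechet_gradient_frechet_gradient)
  then have "frechet_differentiable_at (conjugate \<Phi>) (frechet_gradient \<Phi> g) \<longrightarrow>
      bregman_div \<Phi> g f =
      bregman_div (conjugate \<Phi>) (frechet_gradient \<Phi> f) (frechet_gradient \<Phi> g)"
    unfolding duality bregman_div_def[of "conjugate \<Phi>"] by simp
  moreover have "bregman_div \<Phi> g f =
      bregman_div_gateaux (conjugate \<Phi>) (frechet_gradient \<Phi> f) (frechet_gradient \<Phi> g)"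
    unfolding duality bregman_div_gateaux_def gateaux_gradient_eq[OF dual_grad] by simp
  ultimately show ?thesis using dual_grad unfolding gateaux_differentiable_at_def by blast
qed

end
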